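(* Let $p$ be a propositional variable. The class of all abstract dynamical systems is $\mathsf{DPL}$-definable within the class of all dynamic probability spaces by the set of formulas $$\mathbf{M}:=\{L_r\bigcirc p\leftrightarrow\bigcirc L_rp\mid r\in\mathbb{Q}\cap[0,1]\}.$$ That is, for every dynamic probability space $\mathfrak{P}=\langle\Omega,\mathcal{A},\mu,f\rangle$, every formula of $\mathbf{M}$ is valid in $\mathfrak{P}$ if and only if $\mathfrak{P}$ is an abstract dynamical system, i.e. $\mu(f^{-1}(A))=\mu(A)$ for all $A\in\mathcal{A}$.
   Context: $\mathbb{P}$ is a countable set of propositional variables. $\mathcal{L}_{\mathsf{DPL}}$-formulas: $\varphi ::= p\mid\neg\varphi\mid\varphi\wedge\varphi\mid L_r\varphi\mid\bigcirc\varphi$ with $p\in\mathbb{P}$, $r\in\mathbb{Q}\cap[0,1]$; other Boolean connectives are abbreviations. A dynamic probability space $\langle\Omega,\mathcal{A},\mu,f\rangle$ consists of a probability space $\langle\Omega,\mathcal{A},\mu\rangle$ ($\mu$ $\sigma$-additive, $\Omega\neq\emptyset$) and a measurable $f:\Omega\to\Omega$ (it is identified with the dynamic Markov process $\langle\Omega,\mathcal{A},T,f\rangle$ with constant kernel $T(w,A)=\mu(A)$). An abstract dynamical system is a dynamic probability space in which $f$ is measure-preserving: $\mu(f^{-1}(A))=\mu(A)$ for all $A\in\mathcal{A}$. A model $\mathfrak{M}$ based on such a process adds a valuation $v:\mathbb{P}\to\mathcal{A}$. Satisfaction: $\mathfrak{M},w\vDash p$ iff $w\in v(p)$; Boolean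 clauses as usual; $\mathfrak{M},w\vDash L_r\varphi$ iff $\mu(\{u:\mathfrak{M},u\vDash\varphi\})\ge r$; $\mathfrak{M},w\vDash\bigcirc\varphi$ iff $\mathfrak{M},f(w)\vDash\varphi$. A formula is valid in $\mathfrak{P}$ if it holds at every world of every model based on $\mathfrak{P}$. For classes $\mathcal{C}\subseteq\mathcal{D}$, a set $\Gamma$ of $\mathcal{L}_{\mathsf{DPL}}$-formulas defines $\mathcal{C}$ within $\mathcal{D}$ if for each $\mathfrak{P}\in\mathcal{D}$: $\mathfrak{P}\in\mathcal{C}$ iff all formulas of $\Gamma$ are valid in $\mathfrak{P}$. *)

theory Defs
  imports "HOL-Probability.Probability_Measure" "HOL-Library.Countable"
begin

typedef prob_index = "{r :: rat. 0 \<le> r \<and> r \<le> 1}"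
  by (rule exI[of _ 0]) simp

datatype 'p fm =
    Var 'p
  | Neg "'p fm"
  | Conj "'p fm" "'p fm"
  | L prob_index "'p fm"
  | Next "'p fm"

abbreviation Imp :: "'p fm \<Rightarrow> 'p fm \<Rightarrow> 'p fm" where
  "Imp \<phi> \<psi> \<equiv> Neg (Conj \<phi> (Neg \<psi>))"

abbreviation Iff :: "'p fm \<Rightarrow> 'p fm \<Rightarrow> 'p fm" where
  "Iff \<phi> \<psi> \<equiv> Conj (Imp \<phi> \<psi>) (Imp \<psi> \<phi>)"

locale dynamic_probability_space = prob_space M for M :: "'w measure" +
  fixes f :: "'w \<Rightarrow> 'w"
  assumes measurable_map: "f \<in> M \<rightarrow>\<^sub>M M"

locale abstract_dynamical_system = dynamic_probability_space +
  assumes measure_preserving_map: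
    "A \<in> sets M \<Longrightarrow> measure M (f -` A \<inter> space M) = measure M A"

text \<open>A structure is given by its measure space, which carries \<open>\<Omega>\<close>, the \<open>\<sigma>\<close>-algebra
  and the measure, together with its map. The map is total on the type \<open>'w\<close>, but only its
  values on \<open>space M\<close> matter.\<close>

type_synonym 'w dyn_struct = "'w measure \<times> ('w \<Rightarrow> 'w)"

definition dynamic_probability_spaces :: "'w dyn_struct set" where
  "dynamic_probability_spaces = {(M, f). dynamic_probability_space M f}"

definition abstract_dynamical_systems :: "'w dyn_struct set" where
  "abstract_dynamical_systems = {(M, f). abstract_dynamical_system M f}"

primrec sat :: "'w measure \<Rightarrow> ('w \<Rightarrow> 'w) \<Rightarrow> ('p \<Rightarrow> 'w set) \<Rightarrow> 'w \<Rightarrow> 'p fm \<Rightarrow> bool" where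
  "sat M f v w (Var p) \<longleftrightarrow> w \<in> v p"
| "sat M f v w (Neg \<phi>) \<longleftrightarrow> \<not> sat M f v w \<phi>"
| "sat M f v w (Conj \<phi> \<psi>) \<longleftrightarrow> sat M f v w \<phi> \<and> sat M f v w \<psi>"
| "sat M f v w (L r \<phi>) \<longleftrightarrow>
     measure M {u \<in> space M. sat M f v u \<phi>} \<ge> real_of_rat (Rep_prob_index r)"
| "sat M f v w (Next \<phi>) \<longleftrightarrow> sat M f v (f w) \<phi>"

fun valid_in :: "'w dyn_struct \<Rightarrow> 'p fm \<Rightarrow> bool" where
  "valid_in (M, f) \<phi> \<longleftrightarrow>
     (\<forall>v. (\<forall>p. v p \<in> sets M) \<longrightarrow> (\<forall>w \<in> space M. sat M f v w \<phi>))"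

definition defines_within ::
    "'p fm set \<Rightarrow> 'w dyn_struct set \<Rightarrow> 'w dyn_struct set \<Rightarrow> bool" where
  "defines_within \<Gamma> C D \<longleftrightarrow>
     C \<subseteq> D \<and> (\<forall>P \<in> D. P \<in> C \<longleftrightarrow> (\<forall>\<phi> \<in> \<Gamma>. valid_in P \<phi>))"

definition M_formulas :: "'p \<Rightarrow> 'p fm set" where
  "M_formulas p = {Iff (L r (Next (Var p))) (Next (L r (Var p))) | r. True}"

end

theory Submission
  imports Defs
begin

text \<open>
  Since the kernel is the constant \<open>\<mu>\<close>, a formula \<open>L\<^sub>r \<phi>\<close> has the same truth value at every
  world. If \<open>A\<close> is the value of \<open>p\<close>, then \<open>\<bigcirc>p\<close> is true exactly on the preimage of \<open>A\<close>, so
  the instance of \<open>\<^bold>M\<close> at \<open>r\<close> says that \<open>\<mu>(f\<^sup>-\<^sup>1(A)) \<ge> r\<close> and \<open>\<mu>(A) \<ge> r\<close> are equivalent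
  (\<open>valid_in_M_formula_iff\<close>). As \<open>p\<close> can take any measurable value and a number in the unit
  interval is determined by the rationals of that interval below it
  (\<open>eq_iff_same_prob_index_below\<close>), all instances together say that \<open>f\<close> preserves \<open>\<mu>\<close>.
\<close>

text \<open>If \<open>a < b\<close>, a rational strictly between the two separates them; it is an index
  because \<open>0 \<le> a\<close> and \<open>b \<le> 1\<close> force it into the unit interval.\<close>

lemma le_if_same_prob_index_below:
  fixes a b :: real
  assumes "0 \<le> a" "b \<le> 1"
    and below: "\<And>r. real_of_rat (Rep_prob_index r) \<le> b \<Longrightarrow> real_of_rat (Rep_prob_index r) \<le> a"
  shows "b \<le> a"
proof (rule ccontr)
  assume "\<not> b \<le> a"
  then obtain q where q: "a < real_of_rat q" "real_of_rat q < b"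
    using of_rat_dense[of a b] by auto
  have "0 < real_of_rat q" "real_of_rat q < 1"
    using q assms(1,2) by linarith+
  then have "Rep_prob_index (Abs_prob_index q) = q"
    by (intro Abs_prob_index_inverse) simp
  then show False
    using below[of "Abs_prob_index q"] q by simp
qed

lemma eq_iff_same_prob_index_below:
  fixes a b :: real
  assumes "a \<in> {0..1}" "b \<in> {0..1}"
  shows "a = b \<longleftrightarrow>
    (\<forall>r. real_of_rat (Rep_prob_index r) \<le> a \<longleftrightarrow> real_of_rat (Rep_prob_index r) \<le> b)"
proof
  assume same: "\<forall>r. real_of_rat (Rep_prob_index r) \<le> a \<longleftrightarrow> real_of_rat (Rep_prob_index r) \<le> b"
  show "a = b"
  proof (rule antisym)
    show "a \<le> b"
      by (rule le_if_same_prob_index_below) (use assms same in simp_all)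
    show "b \<le> a"
      by (rule le_if_same_prob_index_below) (use assms same in simp_all)
  qed
qed simp

context dynamic_probability_space
begin

text \<open>Both sides of the formula are statements about \<open>\<mu>\<close> alone: moving from \<open>w\<close> to \<open>f w\<close>
  does not affect the truth of \<open>L\<^sub>r p\<close>, so the world drops out.\<close>

lemma sat_M_formula_iff:
  assumes "w \<in> space M" "v p \<in> sets M"
  shows "sat M f v w (Iff (L r (Next (Var p))) (Next (L r (Var p)))) \<longleftrightarrow>
    (real_of_rat (Rep_prob_index r) \<le> measure M (f -` v p \<inter> space M) \<longleftrightarrow>
     real_of_rat (Rep_prob_index r) \<le> measure M (v p))"
proof -
  have "{u \<in> space M. sat M f v u (Next (Var p))} = f -` v p \<inter> space M"
    by auto
  moreover have "{u \<in> space M. sat M f v u (Var p)} = v p"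
    using sets.sets_into_space[OF assms(2)] by auto
  ultimately show ?thesis
    by auto
qed

text \<open>The valuations that send every variable to one measurable set already realise all
  measurable values of \<open>p\<close>. As \<open>\<Omega>\<close> is nonempty, validity is not vacuous.\<close>

lemma valid_in_M_formula_iff:
  fixes p :: 'p
  shows "valid_in (M, f) (Iff (L r (Next (Var p))) (Next (L r (Var p)))) \<longleftrightarrow>
    (\<forall>A \<in> sets M. real_of_rat (Rep_prob_index r) \<le> measure M (f -` A \<inter> space M) \<longleftrightarrow>
      real_of_rat (Rep_prob_index r) \<le> measure M A)" (is "?valid \<longleftrightarrow> ?same")
proof
  assume valid: ?valid
  obtain w where w: "w \<in> space M"
    using not_empty by blast
  show ?same
  proof
    fix A assume A: "A \<in> sets M"
    then have "sat M f (\<lambda>_. A) w (Iff (L r (Next (Var p))) (Next (L r (Var p))))"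
      using valid[unfolded valid_in.simps, THEN spec, of "\<lambda>_. A"] w by blast
    then show "real_of_rat (Rep_prob_index r) \<le> measure M (f -` A \<inter> space M) \<longleftrightarrow>
      real_of_rat (Rep_prob_index r) \<le> measure M A"
      using sat_M_formula_iff[OF w, of "\<lambda>_. A" p r] A by (simp only:)
  qed
next
  assume same: ?same
  show ?valid
    unfolding valid_in.simps
  proof (intro allI impI ballI)
    fix v :: "'p \<Rightarrow> 'w set" and w
    assume "\<forall>p. v p \<in> sets M" and w: "w \<in> space M"
    then have v: "v p \<in> sets M"
      by blast
    show "sat M f v w (Iff (L r (Next (Var p))) (Next (L r (Var p))))"
      unfolding sat_M_formula_iff[OF w, of v p, OF v] by (rule bspec[OF same v])
  qed
qed

lemma valid_in_M_formulas_iff: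
  "(\<forall>\<phi> \<in> M_formulas p. valid_in (M, f) \<phi>) \<longleftrightarrow>
    (\<forall>A \<in> sets M. measure M (f -` A \<inter> space M) = measure M A)"
proof -
  have "(\<forall>\<phi> \<in> M_formulas p. valid_in (M, f) \<phi>) \<longleftrightarrow>
      (\<forall>r. valid_in (M, f) (Iff (L r (Next (Var p))) (Next (L r (Var p)))))"
    unfolding M_formulas_def by blast
  also have "\<dots> \<longleftrightarrow> (\<forall>A \<in> sets M. measure M (f -` A \<inter> space M) = measure M A)"
  proof -
    have "measure M (f -` A \<inter> space M) = measure M A \<longleftrightarrow>
        (\<forall>r. real_of_rat (Rep_prob_index r) \<le> measure M (f -` A \<inter> space M) \<longleftrightarrow>
          real_of_rat (Rep_prob_index r) \<le> measure M A)" for A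
      by (rule eq_iff_same_prob_index_below) simp_all
    then show ?thesis
      unfolding valid_in_M_formula_iff by blast
  qed
  finally show ?thesis .
qed

end

lemma mem_dynamic_probability_spaces_iff:
  "(M, f) \<in> dynamic_probability_spaces \<longleftrightarrow> dynamic_probability_space M f"
  by (simp only: dynamic_probability_spaces_def mem_Collect_eq prod.case)

lemma mem_abstract_dynamical_systems_iff:
  "(M, f) \<in> abstract_dynamical_systems \<longleftrightarrow> dynamic_probability_space M f \<and>
    (\<forall>A \<in> sets M. measure M (f -` A \<inter> space M) = measure M A)"
  unfolding abstract_dynamical_systems_def mem_Collect_eq prod.case
    abstract_dynamical_system_def abstract_dynamical_system_axioms_def
  by blast

theorem proposition4p2:
  fixes p :: "'p :: countable"
  shows "defines_within (M_formulas p)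
           (abstract_dynamical_systems :: 'w dyn_struct set) dynamic_probability_spaces"
  unfolding defines_within_def
proof
  show "abstract_dynamical_systems \<subseteq> (dynamic_probability_spaces :: 'w dyn_struct set)"
    by (auto simp: mem_dynamic_probability_spaces_iff mem_abstract_dynamical_systems_iff)
  show "\<forall>P \<in> dynamic_probability_spaces. (P :: 'w dyn_struct) \<in> abstract_dynamical_systems \<longleftrightarrow>
      (\<forall>\<phi> \<in> M_formulas p. valid_in P \<phi>)"
  proof
    fix P :: "'w dyn_struct"
    assume mem: "P \<in> dynamic_probability_spaces"
    obtain M f where P: "P = (M, f)"
      by (rule prod.exhaust)
    have space: "dynamic_probability_space M f"
      using mem unfolding P mem_dynamic_probability_spaces_iff .
    show "P \<in> abstract_dynamical_systems \<longleftrightarrow> (\<forall>\<phi> \<in> M_formulas p. valid_in P \<phi>)"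
      unfolding P mem_abstract_dynamical_systems_iff
        dynamic_probability_space.valid_in_M_formulas_iff[OF space]
      by (simp only: space simp_thms)
  qed
qed

end
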